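(* Let $I$ and $O$ be disjoint subsets of $N$, and let $\mathcal{D}_O$ be a coherent set of desirable gambles on $\mathcal{X}_O$. Put $$\mathcal{A}^{\mathrm{irr}}_{I\to O}:=\mathrm{posi}\left(\{\mathbb{I}_{\{x_I\}}g : g\in\mathcal{D}_O,\ x_I\in\mathcal{X}_I\}\right)\subseteq\mathcal{G}(\mathcal{X}_{I\cup O}).$$ Then the smallest (with respect to inclusion) coherent set $\mathcal{D}_N$ of desirable gambles on $\mathcal{X}_N$ such that $\mathrm{marg}_O(\mathcal{D}_N)=\mathcal{D}_O$ and such that $$\mathrm{marg}_O(\mathcal{D}_N\rfloor x_I)=\mathrm{marg}_O(\mathcal{D}_N)\quad\text{for all }x_I\in\mathcal{X}_I$$ (epistemic irrelevance of $X_I$ to $X_O$) exists and is given by $$\mathrm{ext}_N(\mathcal{A}^{\mathrm{irr}}_{I\to O}):=\mathrm{posi}\left(\mathcal{G}(\mathcal{X}_N)_{>0}\cup\mathcal{A}^{\mathrm{irr}}_{I\to O}\right).$$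
   Context: Let $N$ be a finite non-empty index set, and for each $n\in N$ let $\mathcal{X}_n$ be a finite non-empty set. For $R\subseteq N$ let $\mathcal{X}_R:=\prod_{r\in R}\mathcal{X}_r$, with $\mathcal{X}_\emptyset$ a one-point set. Subsets of $N$ are allowed to be empty. For a finite non-empty set $\mathcal{Z}$, a gamble on $\mathcal{Z}$ is a function $\mathcal{Z}\to\mathbb{R}$; $\mathcal{G}(\mathcal{Z})$ is the linear space of all gambles on $\mathcal{Z}$. Write $f\geq g$ for pointwise inequality and $f>g$ if $f\geq g$ and $f\neq g$; $\mathcal{G}(\mathcal{Z})_{>0}:=\{f\in\mathcal{G}(\mathcal{Z}):f>0\}$. For $\mathcal{A}\subseteq\mathcal{G}(\mathcal{Z})$, $\mathrm{posi}(\mathcal{A}):=\{\sum_{k=1}^{m}\lambda_kf_k : m\geq 1,\ f_k\in\mathcal{A},\ \lambda_k>0\}$. A set of desirable gambles $\mathcal{D}\subseteq\mathcal{G}(\mathcal{Z})$ is coherent if (D1) $0\notin\mathcal{D}$; (D2) $\mathcal{G}(\mathcal{Z})_{>0}\subseteq\mathcal{D}$; (D3) $\mathrm{posi}(\mathcal{D})=\mathcal{D}$. For $R\subseteq S\subseteq N$, a gamble $f$ on $\mathcal{X}_R$ is identified with its cylindrical extension $x_S\mapsto f(x_R)$ on $\mathcal{X}_S$; $\mathbb{I}_{\{x_R\}}$ denotes the indicator of $x_R\in\mathcal{X}_R$ (identified in the same way with a gamble on $\mathcal{X}_S$). Marginalisation: for $O\subseteq S\subseteq N$ and $\mathcal{D}\subseteq\mathcal{G}(\mathcal{X}_S)$,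 $\mathrm{marg}_O(\mathcal{D}):=\mathcal{D}\cap\mathcal{G}(\mathcal{X}_O)$. Conditioning: for $I\subseteq S\subseteq N$, $\mathcal{D}\subseteq\mathcal{G}(\mathcal{X}_S)$ and $x_I\in\mathcal{X}_I$, $\mathcal{D}\rfloor x_I:=\{g\in\mathcal{G}(\mathcal{X}_{S\setminus I}):\mathbb{I}_{\{x_I\}}g\in\mathcal{D}\}$. *)

theory Defs
  imports Complex_Main "HOL-Library.FuncSet" "HOL-Library.Indicator_Function"
begin

text \<open>A gamble on \<open>Z\<close> is represented by the real function that agrees with it on \<open>Z\<close> and
  is \<open>0\<close> off \<open>Z\<close>; this makes the representation unique, and makes \<^term>\<open>\<lambda>_. 0 :: real\<close> the
  zero gamble on every \<open>Z\<close>.\<close>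

definition gambles :: "'z set \<Rightarrow> ('z \<Rightarrow> real) set" where
  "gambles Z = {f. \<forall>z. z \<notin> Z \<longrightarrow> f z = 0}"

definition pos_gambles :: "'z set \<Rightarrow> ('z \<Rightarrow> real) set" where
  "pos_gambles Z = {f \<in> gambles Z. (\<forall>z\<in>Z. f z \<ge> 0) \<and> f \<noteq> (\<lambda>_. 0)}"

definition posi :: "('z \<Rightarrow> real) set \<Rightarrow> ('z \<Rightarrow> real) set" where
  "posi A = {(\<lambda>z. \<Sum>k = 1..m. c k * f k z) | (m::nat) (c :: nat \<Rightarrow> real) f.
               m \<ge> 1 \<and> (\<forall>k\<in>{1..m}. f k \<in> A \<and> c k > 0)}"

definition coherent :: "'z set \<Rightarrow> ('z \<Rightarrow> real) set \<Rightarrow> bool" where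
  "coherent Z D \<longleftrightarrow> D \<subseteq> gambles Z \<and> (\<lambda>_. 0) \<notin> D \<and> pos_gambles Z \<subseteq> D \<and> posi D = D"

text \<open>The joint space of the variables in \<open>R\<close> is \<^term>\<open>PiE R X\<close>. The identification of a gamble
  on \<^term>\<open>PiE R X\<close> with its cylindrical extension to \<^term>\<open>PiE S X\<close>, for \<open>R \<subseteq> S\<close>, is the
  explicit map \<open>cyl X R S\<close>.\<close>

definition cyl ::
  "('n \<Rightarrow> 'a set) \<Rightarrow> 'n set \<Rightarrow> 'n set \<Rightarrow> (('n \<Rightarrow> 'a) \<Rightarrow> real) \<Rightarrow> (('n \<Rightarrow> 'a) \<Rightarrow> real)" where
  "cyl X R S f = (\<lambda>x. if x \<in> PiE S X then f (restrict x R) else 0)"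

text \<open>In the next three definitions \<open>S\<close> is the index set on which the gambles in \<open>D\<close> live.\<close>

definition marg ::
  "('n \<Rightarrow> 'a set) \<Rightarrow> 'n set \<Rightarrow> 'n set \<Rightarrow> (('n \<Rightarrow> 'a) \<Rightarrow> real) set \<Rightarrow> (('n \<Rightarrow> 'a) \<Rightarrow> real) set" where
  "marg X S R D = {f \<in> gambles (PiE R X). cyl X R S f \<in> D}"

definition conditional ::
  "('n \<Rightarrow> 'a set) \<Rightarrow> 'n set \<Rightarrow> 'n set \<Rightarrow> (('n \<Rightarrow> 'a) \<Rightarrow> real) set \<Rightarrow> ('n \<Rightarrow> 'a) \<Rightarrow>
     (('n \<Rightarrow> 'a) \<Rightarrow> real) set" where
  "conditional X S I D xI =
     {g \<in> gambles (PiE (S - I) X).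
        (\<lambda>x. cyl X I S (indicat_real {xI}) x * cyl X (S - I) S g x) \<in> D}"

definition epistemically_irrelevant ::
  "('n \<Rightarrow> 'a set) \<Rightarrow> 'n set \<Rightarrow> 'n set \<Rightarrow> 'n set \<Rightarrow> (('n \<Rightarrow> 'a) \<Rightarrow> real) set \<Rightarrow> bool" where
  "epistemically_irrelevant X S I O' D \<longleftrightarrow>
     (\<forall>xI \<in> PiE I X. marg X (S - I) O' (conditional X S I D xI) = marg X S O' D)"

definition irr_assessment ::
  "('n \<Rightarrow> 'a set) \<Rightarrow> 'n set \<Rightarrow> 'n set \<Rightarrow> (('n \<Rightarrow> 'a) \<Rightarrow> real) set \<Rightarrow> (('n \<Rightarrow> 'a) \<Rightarrow> real) set" where
  "irr_assessment X I O' D =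
     posi {(\<lambda>x. cyl X I (I \<union> O') (indicat_real {xI}) x * cyl X O' (I \<union> O') g x) | g xI.
             g \<in> D \<and> xI \<in> PiE I X}"

text \<open>Here \<open>A\<close> consists of gambles on \<^term>\<open>PiE R X\<close>, with \<open>R \<subseteq> N\<close>.\<close>

definition ext ::
  "('n \<Rightarrow> 'a set) \<Rightarrow> 'n set \<Rightarrow> 'n set \<Rightarrow> (('n \<Rightarrow> 'a) \<Rightarrow> real) set \<Rightarrow> (('n \<Rightarrow> 'a) \<Rightarrow> real) set" where
  "ext X N R A = posi (pos_gambles (PiE N X) \<union> cyl X R N ` A)"

definition irr_models ::
  "('n \<Rightarrow> 'a set) \<Rightarrow> 'n set \<Rightarrow> 'n set \<Rightarrow> 'n set \<Rightarrow> (('n \<Rightarrow> 'a) \<Rightarrow> real) set \<Rightarrow>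
     (('n \<Rightarrow> 'a) \<Rightarrow> real) set set" where
  "irr_models X N I O' DO =
     {D. coherent (PiE N X) D \<and> marg X N O' D = DO \<and> epistemically_irrelevant X N I O' D}"

end

theory Submission
  imports Defs
begin

text \<open>A gamble \<open>f\<close> lies in the natural extension of the irrelevance assessment iff it is nonzero and
  dominates a gamble \<open>x \<mapsto> G x\<^sub>I x\<^sub>O\<close> for which every \<open>G x\<^sub>I\<close> is zero or belongs to
  \<open>D\<^sub>O\<close>. Fixing one value of \<open>x\<^sub>I\<close> in this domination, and using that \<open>D\<^sub>O\<close> contains every
  nonzero gamble that dominates zero or one of its elements, shows that neither marginalising nor
  conditioning on \<open>x\<^sub>I\<close> first leads outside \<open>D\<^sub>O\<close>. Minimality holds because
  irrelevance puts every generator of the assessment into the model.\<close>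

section \<open>Positive linear hulls and coherence\<close>

lemma posi_mono:
  assumes "A \<subseteq> B"
  shows "posi A \<subseteq> posi B"
  using assms unfolding posi_def by blast

lemma posi_scale:
  fixes a :: real
  assumes "f \<in> posi A" "a > 0"
  shows "(\<lambda>z. a * f z) \<in> posi A"
proof -
  obtain m :: nat and c g where *: "m \<ge> 1" "\<forall>k\<in>{1..m}. g k \<in> A \<and> c k > 0"
    "f = (\<lambda>z. \<Sum>k = 1..m. c k * g k z)"
    using assms(1) unfolding posi_def by blast
  have "(\<lambda>z. a * f z) = (\<lambda>z. \<Sum>k = 1..m. (a * c k) * g k z)"
    by (simp add: *(3) sum_distrib_left mult.assoc)
  moreover have "\<forall>k\<in>{1..m}. g k \<in> A \<and> a * c k > 0"
    using * assms(2) by simp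
  ultimately show ?thesis
    using *(1) unfolding posi_def by
      (intro CollectI exI[of _ m] exI[of _ "\<lambda>k. a * c k"] exI[of _ g]) simp
qed

lemma posi_add:
  assumes "f \<in> posi A" "g \<in> posi A"
  shows "(\<lambda>z. f z + g z) \<in> posi A"
proof -
  obtain m :: nat and c u where f: "m \<ge> 1" "\<forall>k\<in>{1..m}. u k \<in> A \<and> c k > 0"
    "f = (\<lambda>z. \<Sum>k = 1..m. c k * u k z)"
    using assms(1) unfolding posi_def by blast
  obtain n :: nat and d v where g: "n \<ge> 1" "\<forall>k\<in>{1..n}. v k \<in> A \<and> d k > 0"
    "g = (\<lambda>z. \<Sum>k = 1..n. d k * v k z)"
    using assms(2) unfolding posi_def by blast
  \<comment> \<open>The two combinations are concatenated: indices up to \<open>m\<close> carry the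
    first, and the next \<open>n\<close> carry the second, shifted down by \<open>m\<close> since
    both are numbered from 1.\<close>
  define e where "e k = (if k \<le> m then c k else d (k - m))" for k
  define w where "w k = (if k \<le> m then u k else v (k - m))" for k
  have "f z + g z = (\<Sum>k = 1..m + n. e k * w k z)" for z
  proof -
    have "(\<Sum>k = 1..m + n. e k * w k z)
        = (\<Sum>k = 1..m. e k * w k z) + (\<Sum>k = m + 1..m + n. e k * w k z)"
      by (rule sum.ub_add_nat) simp
    also have "(\<Sum>k = 1..m. e k * w k z) = f z"
      unfolding f(3) by (intro sum.cong) (auto simp: e_def w_def)
    also have "(\<Sum>k = m + 1..m + n. e k * w k z) = (\<Sum>k = 1..n. e (k + m) * w (k + m) z)"
      using sum.shift_bounds_cl_nat_ivl[of "\<lambda>k. e k * w k z" 1 m n] by (simp add: add.commute)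
    also have "\<dots> = g z"
      unfolding g(3) by (intro sum.cong) (auto simp: e_def w_def)
    finally show ?thesis by simp
  qed
  moreover have "w k \<in> A \<and> e k > 0" if k: "k \<in> {1..m + n}" for k
  proof (cases "k \<le> m")
    case True
    then show ?thesis using f(2) k by (simp add: e_def w_def)
  next
    case False
    then have "k - m \<in> {1..n}" using k by auto
    then show ?thesis using g(2) False by (simp add: e_def w_def)
  qed
  ultimately show ?thesis
    using f(1) unfolding posi_def
    by (intro CollectI exI[of _ "m + n"] exI[of _ e] exI[of _ w]) auto
qed

lemma posi_superset: "A \<subseteq> posi A"
proof
  fix f assume "f \<in> A"
  then show "f \<in> posi A"
    unfolding posi_def by (intro CollectI exI[of _ 1] exI[of _ "\<lambda>_. 1"] exI[of _ "\<lambda>_. f"]) simp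
qed

text \<open>Reduces upper bounds on a positive hull to closure checks, so that the later proofs
  never handle the indexed sums in \<open>posi\<close>.\<close>

lemma posi_least:
  assumes "A \<subseteq> C"
    and add: "\<And>f g. f \<in> C \<Longrightarrow> g \<in> C \<Longrightarrow> (\<lambda>z. f z + g z) \<in> C"
    and scale: "\<And>f (a::real). f \<in> C \<Longrightarrow> a > 0 \<Longrightarrow> (\<lambda>z. a * f z) \<in> C"
  shows "posi A \<subseteq> C"
proof
  fix h assume "h \<in> posi A"
  then obtain m :: nat and c f where *: "m \<ge> 1" "\<forall>k\<in>{1..m}. f k \<in> A \<and> c k > 0"
    "h = (\<lambda>z. \<Sum>k = 1..m. c k * f k z)"
    unfolding posi_def by blast
  have "(\<lambda>z. \<Sum>k = 1..m. c k * f k z) \<in> C"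
    using *(1,2)
  \<comment> \<open>The induction starts at one summand: the empty sum would be the zero gamble,
    which \<open>C\<close> may exclude.\<close>
  proof (induction m rule: dec_induct)
    case base
    then show ?case using assms(1) scale by auto
  next
    case (step m)
    then have "(\<lambda>z. \<Sum>k = 1..m. c k * f k z) \<in> C" by simp
    moreover have "f (Suc m) \<in> C" "c (Suc m) > 0"
      using step.prems assms(1) by auto
    then have "(\<lambda>z. c (Suc m) * f (Suc m) z) \<in> C" by (rule scale)
    ultimately show ?case using add by simp
  qed
  then show "h \<in> C" using *(3) by simp
qed

lemma coherent_add:
  assumes "coherent Z D" "f \<in> D" "g \<in> D"
  shows "(\<lambda>z. f z + g z) \<in> D"
  using assms posi_add unfolding coherent_def by metis

lemma coherent_scale:
  assumes "coherent Z D" "f \<in> D" "(a::real) > 0"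
  shows "(\<lambda>z. a * f z) \<in> D"
  using assms posi_scale unfolding coherent_def by metis

lemma coherent_gambles:
  assumes "coherent Z D" "f \<in> D"
  shows "f \<in> gambles Z"
  using assms unfolding coherent_def by auto

lemma zero_in_gambles: "(\<lambda>_. 0) \<in> gambles Z"
  by (simp add: gambles_def)

text \<open>Unless \<open>f = g\<close>, the difference \<open>f - g\<close> is a positive gamble,
  hence in \<open>D\<close>, and adding \<open>g\<close> to it gives \<open>f\<close>.\<close>

lemma coherent_dominating:
  assumes "coherent Z D" "g \<in> insert (\<lambda>_. 0) D" "f \<in> gambles Z" "f \<noteq> (\<lambda>_. 0)"
    and le: "\<And>z. z \<in> Z \<Longrightarrow> g z \<le> f z"
  shows "f \<in> D"
proof (cases "f = g")
  case True
  then show ?thesis using assms by auto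
next
  case False
  have "g \<in> gambles Z" using assms coherent_gambles zero_in_gambles by blast
  then have "(\<lambda>z. f z - g z) \<in> pos_gambles Z"
    using assms False by (auto simp: pos_gambles_def gambles_def fun_eq_iff)
  then have *: "(\<lambda>z. f z - g z) \<in> D" using assms(1) by (auto simp: coherent_def)
  show ?thesis
  proof (cases "g \<in> D")
    case True
    then show ?thesis using coherent_add[OF assms(1) * True] by simp
  next
    case False
    then show ?thesis using assms(2) * by auto
  qed
qed

text \<open>Otherwise \<open>- g\<close> would be a positive gamble, and \<open>D\<close> would
  contain \<open>g\<close>, \<open>- g\<close> and thus their sum, zero.\<close>

lemma coherent_nonpos_zero:
  assumes "coherent Z D" "g \<in> insert (\<lambda>_. 0) D" and le: "\<And>z. z \<in> Z \<Longrightarrow> g z \<le> 0"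
  shows "g = (\<lambda>_. 0)"
proof (rule ccontr)
  assume nz: "g \<noteq> (\<lambda>_. 0)"
  then have g: "g \<in> D" using assms by auto
  then have "(\<lambda>z. - g z) \<in> pos_gambles Z"
    using coherent_gambles[OF assms(1) g] nz le
    by (auto simp: pos_gambles_def gambles_def fun_eq_iff)
  then have "(\<lambda>z. - g z) \<in> D" using assms(1) by (auto simp: coherent_def)
  from coherent_add[OF assms(1) g this] show False
    using assms(1) by (simp add: coherent_def)
qed

section \<open>The natural extension of the irrelevance assessment\<close>

text \<open>Disjointness makes the prescriptions \<open>u\<close> and \<open>y\<close> compatible;
  the remaining coordinates are copied from an arbitrary point of the joint space.\<close>

lemma ex_common_extension:
  assumes "PiE N X \<noteq> {}" "I \<subseteq> N" "O' \<subseteq> N" "I \<inter> O' = {}"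
    and "u \<in> PiE I X" "y \<in> PiE O' X"
  obtains x where "x \<in> PiE N X" "restrict x I = u" "restrict x O' = y"
proof -
  obtain z where z: "z \<in> PiE N X" using assms(1) by blast
  define x where "x n = (if n \<in> I then u n else if n \<in> O' then y n else z n)" for n
  have "x \<in> PiE N X"
  proof (rule PiE_I)
    show "x n \<in> X n" if "n \<in> N" for n
      using that PiE_mem[OF z] PiE_mem[OF assms(5)] PiE_mem[OF assms(6)] by (simp add: x_def)
    show "x n = undefined" if "n \<notin> N" for n
      using that assms(2,3) PiE_arb[OF z] by (auto simp: x_def)
  qed
  moreover have "restrict x I = u"
    using PiE_restrict[OF assms(5)] by (metis restrict_ext x_def)
  moreover have "restrict x O' = y"
  proof -
    have "restrict x O' = restrict y O'"
      using assms(4) by (intro restrict_ext) (auto simp: x_def)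
    then show ?thesis using PiE_restrict[OF assms(6)] by simp
  qed
  ultimately show ?thesis by (rule that)
qed

text \<open>The product of \<open>g\<close> with the indicator of \<open>u\<close>, extended to the
  joint space of \<open>N\<close>. A single case distinction is easier to calculate with than a
  product of two \<open>cyl\<close> terms.\<close>

definition cond_gamble ::
  "('n \<Rightarrow> 'a set) \<Rightarrow> 'n set \<Rightarrow> 'n set \<Rightarrow> 'n set \<Rightarrow> ('n \<Rightarrow> 'a) \<Rightarrow>
     (('n \<Rightarrow> 'a) \<Rightarrow> real) \<Rightarrow> (('n \<Rightarrow> 'a) \<Rightarrow> real)" where
  "cond_gamble X N I O' u g =
     (\<lambda>x. if x \<in> PiE N X \<and> restrict x I = u then g (restrict x O') else 0)"

text \<open>A description of the natural extension without sums: \<open>G u\<close> is the part of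
  the assessment used on the slice where the \<open>I\<close>-coordinates equal \<open>u\<close>,
  and is zero where nothing is used. Requiring \<open>f\<close> to be nonzero excludes the zero
  gamble, which dominates the zero family.\<close>

definition dominating_gambles ::
  "('n \<Rightarrow> 'a set) \<Rightarrow> 'n set \<Rightarrow> 'n set \<Rightarrow> 'n set \<Rightarrow> (('n \<Rightarrow> 'a) \<Rightarrow> real) set \<Rightarrow>
     (('n \<Rightarrow> 'a) \<Rightarrow> real) set" where
  "dominating_gambles X N I O' D =
     {f \<in> gambles (PiE N X). f \<noteq> (\<lambda>_. 0) \<and>
        (\<exists>G. (\<forall>u\<in>PiE I X. G u \<in> insert (\<lambda>_. 0) D) \<and>
             (\<forall>x\<in>PiE N X. G (restrict x I) (restrict x O') \<le> f x))}"

section \<open>Cylindrical extensions and the generators of the assessment\<close>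

lemma restrict_in_PiE:
  assumes "x \<in> PiE N X" "R \<subseteq> N"
  shows "restrict x R \<in> PiE R X"
  using assms by (auto simp: restrict_PiE_iff PiE_mem)

lemma cyl_in_gambles: "cyl X R S f \<in> gambles (PiE S X)"
  by (simp add: cyl_def gambles_def)

text \<open>Since \<open>cyl\<close> is linear, the preimage of a positive hull under it is closed
  under sums and positive multiples, so \<open>posi_least\<close> applies.\<close>

lemma cyl_posi: "cyl X R S ` posi A \<subseteq> posi (cyl X R S ` A)"
proof -
  have "posi A \<subseteq> {f. cyl X R S f \<in> posi (cyl X R S ` A)}"
  proof (rule posi_least)
    show "A \<subseteq> {f. cyl X R S f \<in> posi (cyl X R S ` A)}"
      using posi_superset by blast
  next
    fix f g assume "f \<in> {f. cyl X R S f \<in> posi (cyl X R S ` A)}"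
      "g \<in> {f. cyl X R S f \<in> posi (cyl X R S ` A)}"
    then have "(\<lambda>x. cyl X R S f x + cyl X R S g x) \<in> posi (cyl X R S ` A)"
      using posi_add by blast
    also have "(\<lambda>x. cyl X R S f x + cyl X R S g x) = cyl X R S (\<lambda>z. f z + g z)"
      by (auto simp: cyl_def)
    finally show "(\<lambda>z. f z + g z) \<in> {f. cyl X R S f \<in> posi (cyl X R S ` A)}" by simp
  next
    fix f and a :: real assume "f \<in> {f. cyl X R S f \<in> posi (cyl X R S ` A)}" "a > 0"
    then have "(\<lambda>x. a * cyl X R S f x) \<in> posi (cyl X R S ` A)"
      using posi_scale by blast
    also have "(\<lambda>x. a * cyl X R S f x) = cyl X R S (\<lambda>z. a * f z)"
      by (auto simp: cyl_def)
    finally show "(\<lambda>z. a * f z) \<in> {f. cyl X R S f \<in> posi (cyl X R S ` A)}" by simp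
  qed
  then show ?thesis by blast
qed

lemma indicator_times_cyl:
  "(\<lambda>x. cyl X I S (indicat_real {u}) x * cyl X O' S g x) = cond_gamble X S I O' u g"
  by (auto simp: cyl_def cond_gamble_def indicator_def)

text \<open>Restricting through \<open>R\<close> agrees with restricting directly to
  \<open>I\<close> or \<open>O'\<close>. This moves the generators from the joint space of
  \<open>I \<union> O'\<close> to that of \<open>N\<close>.\<close>

lemma cyl_cond_gamble:
  assumes "I \<subseteq> R" "O' \<subseteq> R" "R \<subseteq> N"
  shows "cyl X R N (cond_gamble X R I O' u g) = cond_gamble X N I O' u g"
proof
  fix x
  have "R \<inter> I = I" "R \<inter> O' = O'" using assms by auto
  then show "cyl X R N (cond_gamble X R I O' u g) x = cond_gamble X N I O' u g x"
    using restrict_in_PiE[OF _ assms(3), of x X]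
    by (cases "x \<in> PiE N X") (simp_all add: cyl_def cond_gamble_def)
qed

lemma cond_gamble_in_gambles: "cond_gamble X N I O' u g \<in> gambles (PiE N X)"
  by (simp add: cond_gamble_def gambles_def)

lemma irr_assessment_eq:
  "irr_assessment X I O' D = posi {cond_gamble X (I \<union> O') I O' u g | g u. g \<in> D \<and> u \<in> PiE I X}"
  by (simp add: irr_assessment_def indicator_times_cyl)

lemma irr_assessment_subset_gambles: "irr_assessment X I O' D \<subseteq> gambles (PiE (I \<union> O') X)"
  unfolding irr_assessment_eq
proof (rule posi_least)
  show "{cond_gamble X (I \<union> O') I O' u g | g u. g \<in> D \<and> u \<in> PiE I X} \<subseteq> gambles (PiE (I \<union> O') X)"
    using cond_gamble_in_gambles by blast
qed (simp_all add: gambles_def)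

lemma cyl_generators:
  assumes "I \<subseteq> N" "O' \<subseteq> N"
  shows "cyl X (I \<union> O') N ` {cond_gamble X (I \<union> O') I O' u g | g u. g \<in> D \<and> u \<in> PiE I X}
    = {cond_gamble X N I O' u g | g u. g \<in> D \<and> u \<in> PiE I X}"
proof -
  have "cyl X (I \<union> O') N (cond_gamble X (I \<union> O') I O' u g) = cond_gamble X N I O' u g" for u g
    using assms by (intro cyl_cond_gamble) auto
  then show ?thesis by (auto simp: image_iff) metis
qed

text \<open>Disjointness gives \<open>O' \<subseteq> N - I\<close>, so extending \<open>f\<close>
  through \<open>N - I\<close> is the same as extending it directly.\<close>

lemma marg_conditional:
  assumes "O' \<subseteq> N" "I \<inter> O' = {}"
  shows "marg X (N - I) O' (conditional X N I D u)
    = {f \<in> gambles (PiE O' X). cond_gamble X N I O' u f \<in> D}"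
proof -
  have "cond_gamble X N I (N - I) u (cyl X O' (N - I) f) = cond_gamble X N I O' u f" for f
  proof
    fix x
    have "(N - I) \<inter> O' = O'" using assms by auto
    then show "cond_gamble X N I (N - I) u (cyl X O' (N - I) f) x = cond_gamble X N I O' u f x"
      using restrict_in_PiE[of x N X "N - I"]
      by (cases "x \<in> PiE N X") (simp_all add: cyl_def cond_gamble_def)
  qed
  then show ?thesis
    by (simp add: marg_def conditional_def cyl_in_gambles indicator_times_cyl)
qed

text \<open>A coherent set already contains the positive gambles and its own positive hull, so only
  the generators remain to be checked. Applied both to the set of dominating gambles and to an
  arbitrary irrelevant model.\<close>

lemma ext_least:
  assumes "I \<subseteq> N" "O' \<subseteq> N" "coherent (PiE N X) C"
    and "\<And>g u. g \<in> D \<Longrightarrow> u \<in> PiE I X \<Longrightarrow> cond_gamble X N I O' u g \<in> C"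
  shows "ext X N (I \<union> O') (irr_assessment X I O' D) \<subseteq> C"
proof -
  have C: "posi C = C" "pos_gambles (PiE N X) \<subseteq> C"
    using assms(3) by (auto simp: coherent_def)
  have "cyl X (I \<union> O') N ` irr_assessment X I O' D
      \<subseteq> posi {cond_gamble X N I O' u g | g u. g \<in> D \<and> u \<in> PiE I X}"
    unfolding irr_assessment_eq cyl_generators[OF assms(1,2), symmetric] by (rule cyl_posi)
  also have "\<dots> \<subseteq> posi C" using assms(4) by (intro posi_mono) auto
  finally have "posi (pos_gambles (PiE N X) \<union> cyl X (I \<union> O') N ` irr_assessment X I O' D) \<subseteq> posi C"
    using C by (intro posi_mono) auto
  then show ?thesis using C by (simp add: ext_def)
qed

lemma cond_gamble_in_ext:
  assumes "I \<subseteq> N" "O' \<subseteq> N" "g \<in> D" "u \<in> PiE I X"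
  shows "cond_gamble X N I O' u g \<in> ext X N (I \<union> O') (irr_assessment X I O' D)"
proof -
  have "cond_gamble X (I \<union> O') I O' u g \<in> irr_assessment X I O' D"
    unfolding irr_assessment_eq using assms by (intro subsetD[OF posi_superset]) auto
  moreover have "cyl X (I \<union> O') N (cond_gamble X (I \<union> O') I O' u g) = cond_gamble X N I O' u g"
    using assms by (intro cyl_cond_gamble) auto
  ultimately show ?thesis
    unfolding ext_def by (intro subsetD[OF posi_superset]) (metis UnI2 imageI)
qed

section \<open>Coherence of the set of dominating gambles\<close>

text \<open>Sums and positive multiples are dominated slice by slice. The delicate point is that two
  members never sum to zero.\<close>

lemma coherent_dominating_gambles:
  assumes N: "PiE N X \<noteq> {}" "I \<subseteq> N" "O' \<subseteq> N" "I \<inter> O' = {}"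
    and D: "coherent (PiE O' X) D"
  shows "coherent (PiE N X) (dominating_gambles X N I O' D)"
  unfolding coherent_def
proof (intro conjI)
  let ?E = "dominating_gambles X N I O' D"
  show "?E \<subseteq> gambles (PiE N X)" "(\<lambda>_. 0) \<notin> ?E"
    by (auto simp: dominating_gambles_def)
  show "pos_gambles (PiE N X) \<subseteq> ?E"
    unfolding pos_gambles_def dominating_gambles_def
    by (auto intro!: exI[of _ "\<lambda>_ _. 0"])
  show "posi ?E = ?E"
  proof (intro equalityI posi_superset posi_least order_refl)
    fix f g assume "f \<in> ?E" "g \<in> ?E"
    from \<open>f \<in> ?E\<close> obtain F where f: "f \<in> gambles (PiE N X)" "f \<noteq> (\<lambda>_. 0)"
        "\<And>u. u \<in> PiE I X \<Longrightarrow> F u \<in> insert (\<lambda>_. 0) D"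
        "\<And>x. x \<in> PiE N X \<Longrightarrow> F (restrict x I) (restrict x O') \<le> f x"
      unfolding dominating_gambles_def by auto
    from \<open>g \<in> ?E\<close> obtain G where g: "g \<in> gambles (PiE N X)"
        "\<And>u. u \<in> PiE I X \<Longrightarrow> G u \<in> insert (\<lambda>_. 0) D"
        "\<And>x. x \<in> PiE N X \<Longrightarrow> G (restrict x I) (restrict x O') \<le> g x"
      unfolding dominating_gambles_def by auto
    let ?H = "\<lambda>u y. F u y + G u y"
    have H: "?H u \<in> insert (\<lambda>_. 0) D" if "u \<in> PiE I X" for u
      using f(3)[OF that] g(2)[OF that] coherent_add[OF D, of "F u" "G u"] by auto
    have "(\<lambda>x. f x + g x) \<noteq> (\<lambda>_. 0)"
    proof
      assume "(\<lambda>x. f x + g x) = (\<lambda>_. 0)"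
      then have sum0: "f x + g x = 0" for x by (rule fun_cong)
      \<comment> \<open>If \<open>f + g\<close> vanishes, then \<open>F u + G u\<close> is
        nonpositive and therefore zero. Two elements of \<open>D\<close> cannot cancel, so one of
        \<open>F u\<close> and \<open>G u\<close> is zero, and then so is the other.\<close>
      have FG: "F u = (\<lambda>_. 0) \<and> G u = (\<lambda>_. 0)" if u: "u \<in> PiE I X" for u
      proof -
        have "?H u = (\<lambda>_. 0)"
        proof (rule coherent_nonpos_zero[OF D H[OF u]])
          fix y assume "y \<in> PiE O' X"
          then obtain x where "x \<in> PiE N X" "restrict x I = u" "restrict x O' = y"
            using ex_common_extension[OF N u] by blast
          then show "?H u y \<le> 0" using f(4)[of x] g(3)[of x] sum0[of x] by simp
        qed
        moreover from this have "F u \<in> D \<Longrightarrow> G u \<in> D \<Longrightarrow> False"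
          using coherent_add[OF D, of "F u" "G u"] D by (auto simp: coherent_def)
        ultimately show ?thesis
          using f(3)[OF u] g(2)[OF u] by (auto simp: fun_eq_iff)
      qed
      \<comment> \<open>With zero families, \<open>f\<close> and \<open>g\<close> are both
        nonnegative, so a vanishing sum forces \<open>f\<close> to vanish.\<close>
      have "f x = 0" for x
      proof (cases "x \<in> PiE N X")
        case True
        then show ?thesis
          using f(4)[OF True] g(3)[OF True] FG[OF restrict_in_PiE[OF True N(2)]] sum0[of x]
          by simp
      next
        case False
        then show ?thesis using f(1) by (simp add: gambles_def)
      qed
      then show False using f(2) by auto
    qed
    moreover have "(\<lambda>x. f x + g x) \<in> gambles (PiE N X)"
      using f(1) g(1) by (simp add: gambles_def)
    ultimately show "(\<lambda>x. f x + g x) \<in> ?E"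
      unfolding dominating_gambles_def using H f(4) g(3)
      by (auto intro!: exI[of _ ?H] add_mono)
  next
    fix f and a :: real assume "f \<in> ?E" and a: "a > 0"
    then obtain F where f: "f \<in> gambles (PiE N X)" "f \<noteq> (\<lambda>_. 0)"
        "\<And>u. u \<in> PiE I X \<Longrightarrow> F u \<in> insert (\<lambda>_. 0) D"
        "\<And>x. x \<in> PiE N X \<Longrightarrow> F (restrict x I) (restrict x O') \<le> f x"
      unfolding dominating_gambles_def by auto
    let ?H = "\<lambda>u y. a * F u y"
    have "?H u \<in> insert (\<lambda>_. 0) D" if "u \<in> PiE I X" for u
      using f(3)[OF that] coherent_scale[OF D, of "F u" a] a by auto
    moreover have "(\<lambda>x. a * f x) \<in> gambles (PiE N X)" "(\<lambda>x. a * f x) \<noteq> (\<lambda>_. 0)"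
      using f(1,2) a by (auto simp: gambles_def fun_eq_iff)
    ultimately show "(\<lambda>x. a * f x) \<in> ?E"
      unfolding dominating_gambles_def using f(4) a
      by (auto intro!: exI[of _ ?H])
  qed
qed

text \<open>The witness family is \<open>g\<close> at \<open>u\<close> and zero elsewhere. The
  product is nonzero at a common extension of \<open>u\<close> and a point where \<open>g\<close> is
  nonzero.\<close>

lemma cond_gamble_in_dominating_gambles:
  assumes N: "PiE N X \<noteq> {}" "I \<subseteq> N" "O' \<subseteq> N" "I \<inter> O' = {}"
    and D: "coherent (PiE O' X) D" and g: "g \<in> D" and u: "u \<in> PiE I X"
  shows "cond_gamble X N I O' u g \<in> dominating_gambles X N I O' D"
proof -
  have "g \<noteq> (\<lambda>_. 0)" using D g by (auto simp: coherent_def)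
  then obtain y where y: "g y \<noteq> 0" by auto
  then have "y \<in> PiE O' X" using coherent_gambles[OF D g] by (auto simp: gambles_def)
  then obtain x where "x \<in> PiE N X" "restrict x I = u" "restrict x O' = y"
    using ex_common_extension[OF N u] by blast
  then have "cond_gamble X N I O' u g x \<noteq> 0" using y by (simp add: cond_gamble_def)
  then have "cond_gamble X N I O' u g \<noteq> (\<lambda>_. 0)" by auto
  then show ?thesis
    unfolding dominating_gambles_def using g
    by (auto simp: cond_gamble_def gambles_def intro!: exI[of _ "\<lambda>v. if v = u then g else (\<lambda>_. 0)"])
qed

text \<open>Evaluating the domination on the slice \<open>x\<^sub>I = u\<close> handles the marginal and the
  conditional models alike: \<open>h\<close> is the cylindrical extension of \<open>f\<close> or its product with the
  indicator of \<open>u\<close>.\<close>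

lemma dominating_gambles_slice:
  assumes N: "PiE N X \<noteq> {}" "I \<subseteq> N" "O' \<subseteq> N" "I \<inter> O' = {}"
    and D: "coherent (PiE O' X) D" and h: "h \<in> dominating_gambles X N I O' D"
    and u: "u \<in> PiE I X" and f: "f \<in> gambles (PiE O' X)" "f \<noteq> (\<lambda>_. 0)"
    and eq: "\<And>x. x \<in> PiE N X \<Longrightarrow> restrict x I = u \<Longrightarrow> h x = f (restrict x O')"
  shows "f \<in> D"
proof -
  obtain G where G: "\<And>u. u \<in> PiE I X \<Longrightarrow> G u \<in> insert (\<lambda>_. 0) D"
    "\<And>x. x \<in> PiE N X \<Longrightarrow> G (restrict x I) (restrict x O') \<le> h x"
    using h unfolding dominating_gambles_def by auto
  show ?thesis
  proof (rule coherent_dominating[OF D G(1)[OF u] f])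
    fix y assume "y \<in> PiE O' X"
    then obtain x where "x \<in> PiE N X" "restrict x I = u" "restrict x O' = y"
      using ex_common_extension[OF N u] by blast
    then show "G u y \<le> f y" using G(2)[of x] eq[of x] by simp
  qed
qed

lemma marg_conditional_dominating_gambles:
  assumes N: "PiE N X \<noteq> {}" "I \<subseteq> N" "O' \<subseteq> N" "I \<inter> O' = {}"
    and D: "coherent (PiE O' X) D" and u: "u \<in> PiE I X"
  shows "marg X (N - I) O' (conditional X N I (dominating_gambles X N I O' D) u) = D"
proof -
  let ?E = "dominating_gambles X N I O' D"
  have "f \<in> D" if f: "f \<in> gambles (PiE O' X)" "cond_gamble X N I O' u f \<in> ?E" for f
  proof (rule dominating_gambles_slice[OF N D f(2) u f(1)])
    show "f \<noteq> (\<lambda>_. 0)"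
    proof
      assume "f = (\<lambda>_. 0)"
      then have "cond_gamble X N I O' u f = (\<lambda>_. 0)" by (auto simp: cond_gamble_def)
      then show False using f(2) by (auto simp: dominating_gambles_def)
    qed
  qed (simp add: cond_gamble_def)
  then show ?thesis
    unfolding marg_conditional[OF N(3,4)]
    using coherent_gambles[OF D] cond_gamble_in_dominating_gambles[OF N D _ u] by blast
qed

lemma marg_dominating_gambles:
  assumes N: "PiE N X \<noteq> {}" "I \<subseteq> N" "O' \<subseteq> N" "I \<inter> O' = {}"
    and D: "coherent (PiE O' X) D"
  shows "marg X N O' (dominating_gambles X N I O' D) = D"
proof -
  let ?E = "dominating_gambles X N I O' D"
  \<comment> \<open>Any slice recovers \<open>f\<close>, because its cylindrical extension is the
    same on all of them.\<close>
  obtain u where u: "u \<in> PiE I X"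
    using N(1) restrict_in_PiE[OF _ N(2)] by blast
  have "f \<in> D" if f: "f \<in> gambles (PiE O' X)" "cyl X O' N f \<in> ?E" for f
  proof (rule dominating_gambles_slice[OF N D f(2) u f(1)])
    show "f \<noteq> (\<lambda>_. 0)"
    proof
      assume "f = (\<lambda>_. 0)"
      then have "cyl X O' N f = (\<lambda>_. 0)" by (auto simp: cyl_def)
      then show False using f(2) by (auto simp: dominating_gambles_def)
    qed
  qed (simp add: cyl_def)
  moreover have "cyl X O' N g \<in> ?E" if g: "g \<in> D" for g
  proof -
    \<comment> \<open>The cylindrical extension of \<open>g\<close> cannot vanish if its product
      with an indicator does not. The constant family \<open>g\<close> then witnesses the
      domination.\<close>
    have "cond_gamble X N I O' u g \<noteq> (\<lambda>_. 0)"
      using cond_gamble_in_dominating_gambles[OF N D g u] by (auto simp: dominating_gambles_def)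
    then have "cyl X O' N g \<noteq> (\<lambda>_. 0)"
      by (auto simp: cond_gamble_def cyl_def fun_eq_iff) metis
    moreover have "g (restrict x O') \<le> cyl X O' N g x" if "x \<in> PiE N X" for x
      using that by (simp add: cyl_def)
    ultimately show ?thesis
      unfolding dominating_gambles_def using g
      by (auto simp: cyl_in_gambles intro!: exI[of _ "\<lambda>_. g"])
  qed
  ultimately show ?thesis
    unfolding marg_def using coherent_gambles[OF D] by blast
qed

section \<open>Identification with the natural extension\<close>

text \<open>One inclusion is minimality of the extension among coherent sets containing the
  generators. For the other, a dominating gamble is split into finitely many generators and a
  nonnegative remainder, which is where finiteness enters.\<close>

lemma ext_eq_dominating_gambles:
  assumes N: "PiE N X \<noteq> {}" "I \<subseteq> N" "O' \<subseteq> N" "I \<inter> O' = {}"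
    and fin: "finite (PiE I X)" and D: "coherent (PiE O' X) D"
  shows "ext X N (I \<union> O') (irr_assessment X I O' D) = dominating_gambles X N I O' D"
    (is "?ext = ?E")
proof
  show "?ext \<subseteq> ?E"
    using ext_least[OF N(2,3) coherent_dominating_gambles[OF N D]]
      cond_gamble_in_dominating_gambles[OF N D] by blast
  have pos: "pos_gambles (PiE N X) \<subseteq> ?ext"
    unfolding ext_def using posi_superset by blast
  have add: "(\<lambda>x. f x + g x) \<in> ?ext" if "f \<in> ?ext" "g \<in> ?ext" for f g
    using that unfolding ext_def by (rule posi_add)
  \<comment> \<open>\<open>U\<close> collects the slices whose \<open>G u\<close> is still to be
    subtracted; on all other slices \<open>f\<close> is only required to be nonnegative. For empty
    \<open>U\<close> a positive gamble is left.\<close>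
  have peel: "f \<in> ?ext"
    if "finite U" "U \<subseteq> PiE I X" "f \<in> gambles (PiE N X)" "f \<noteq> (\<lambda>_. 0)"
      "\<And>u. u \<in> U \<Longrightarrow> G u \<in> insert (\<lambda>_. 0) D"
      "\<And>x. x \<in> PiE N X \<Longrightarrow> (if restrict x I \<in> U then G (restrict x I) (restrict x O') else 0) \<le> f x"
    for U f G
    using that
  proof (induction U arbitrary: f rule: finite_induct)
    case empty
    then show ?case using pos by (auto simp: pos_gambles_def)
  next
    case (insert u U)
    let ?c = "cond_gamble X N I O' u (G u)"
    \<comment> \<open>The induction hypothesis covers only a nonzero remainder; when the remainder
      is zero, \<open>f\<close> is itself \<open>?c\<close>.\<close>
    have IH: "(\<lambda>x. f x - ?c x) \<in> ?ext" if "(\<lambda>x. f x - ?c x) \<noteq> (\<lambda>_. 0)"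
    proof (rule insert.IH[OF _ _ that])
      show "(\<lambda>x. f x - ?c x) \<in> gambles (PiE N X)"
        using insert.prems(2) by (simp add: gambles_def cond_gamble_def)
      fix x assume "x \<in> PiE N X"
      then show "(if restrict x I \<in> U then G (restrict x I) (restrict x O') else 0) \<le> f x - ?c x"
        using insert.prems(5)[of x] insert.hyps(2)
        by (cases "restrict x I = u"; cases "restrict x I \<in> U")
          (simp_all add: cond_gamble_def del: restrict_apply restrict_apply')
    qed (use insert.prems in auto)
    show ?case
    proof (cases "G u = (\<lambda>_. 0)")
      case True
      then have "?c = (\<lambda>_. 0)" by (auto simp: cond_gamble_def)
      then show ?thesis using IH insert.prems(3) by simp
    next
      case False
      then have c: "?c \<in> ?ext"
        using insert.prems by (intro cond_gamble_in_ext[OF N(2,3)]) auto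
      show ?thesis
      proof (cases "(\<lambda>x. f x - ?c x) = (\<lambda>_. 0)")
        case True
        then have "f = ?c" by (auto simp: fun_eq_iff)
        then show ?thesis using c by simp
      next
        case False
        from add[OF IH[OF False] c] show ?thesis by simp
      qed
    qed
  qed
  show "?E \<subseteq> ?ext"
  proof
    fix f assume "f \<in> ?E"
    then obtain G where "f \<in> gambles (PiE N X)" "f \<noteq> (\<lambda>_. 0)"
        "\<And>u. u \<in> PiE I X \<Longrightarrow> G u \<in> insert (\<lambda>_. 0) D"
        "\<And>x. x \<in> PiE N X \<Longrightarrow> G (restrict x I) (restrict x O') \<le> f x"
      unfolding dominating_gambles_def by auto
    then show "f \<in> ?ext"
      by (intro peel[OF fin order_refl]) (simp_all only: restrict_in_PiE[OF _ N(2)] if_True not_False_eq_True)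
  qed
qed

theorem theorem13:
  fixes N I O' :: "'n set"
    and X :: "'n \<Rightarrow> 'a set"
    and DO :: "(('n \<Rightarrow> 'a) \<Rightarrow> real) set"
  assumes "finite N" and "N \<noteq> {}"
    and "\<And>n. n \<in> N \<Longrightarrow> finite (X n) \<and> X n \<noteq> {}"
    and "I \<subseteq> N" and "O' \<subseteq> N" and "I \<inter> O' = {}"
    and "coherent (PiE O' X) DO"
  shows "irr_assessment X I O' DO \<subseteq> gambles (PiE (I \<union> O') X)
    \<and> ext X N (I \<union> O') (irr_assessment X I O' DO) \<in> irr_models X N I O' DO
    \<and> (\<forall>D \<in> irr_models X N I O' DO. ext X N (I \<union> O') (irr_assessment X I O' DO) \<subseteq> D)"
proof (intro conjI ballI)
  let ?ext = "ext X N (I \<union> O') (irr_assessment X I O' DO)"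
  have N: "PiE N X \<noteq> {}" "I \<subseteq> N" "O' \<subseteq> N" "I \<inter> O' = {}"
    using assms by (auto simp: PiE_eq_empty_iff)
  have fin: "finite (PiE I X)"
    using assms(1,3,4) by (intro finite_PiE) (auto intro: finite_subset)
  note eq = ext_eq_dominating_gambles[OF N fin assms(7)]
  show "irr_assessment X I O' DO \<subseteq> gambles (PiE (I \<union> O') X)"
    by (rule irr_assessment_subset_gambles)
  show "?ext \<in> irr_models X N I O' DO"
    unfolding eq irr_models_def epistemically_irrelevant_def
    by (simp add: coherent_dominating_gambles[OF N assms(7)] marg_dominating_gambles[OF N assms(7)]
        marg_conditional_dominating_gambles[OF N assms(7)])
  fix D assume "D \<in> irr_models X N I O' DO"
  then have D: "coherent (PiE N X) D"
    and "\<And>u. u \<in> PiE I X \<Longrightarrow> marg X (N - I) O' (conditional X N I D u) = DO"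
    unfolding irr_models_def epistemically_irrelevant_def by auto
  \<comment> \<open>Irrelevance and the prescribed marginal make each conditional marginal of
    \<open>D\<close> equal to \<open>DO\<close>, which by \<open>marg_conditional\<close> puts every
    generator into \<open>D\<close>.\<close>
  then have "cond_gamble X N I O' u g \<in> D" if "g \<in> DO" "u \<in> PiE I X" for g u
    using that marg_conditional[OF N(3,4)] by blast
  then show "?ext \<subseteq> D" by (rule ext_least[OF N(2,3) D])
qed

end
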